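(* Let $x^*$ be an optimal solution of the joint assortment and price optimization problem (A&P) and let $\widehat x$ be (the $x$-part of) an optimal solution of its approximation (A&P-LFP), both described in the context, where the interpolants used have maximum relative errors at most $\epsilon\in(0,1)$. Then $$\frac{1-\epsilon}{1+\epsilon}F(x^* )\le F(\widehat x)\le F(x^* ).$$
   Context: Setting: $m$ products, $N$ nests $S_1=\dots=S_N=[m]$, $L$ price levels; product $i$ may be offered at one price among $p_{i1},\dots,p_{iL}\ge0$, and has preference weight $v_{il}\ge0$ when priced at $p_{il}$. Allocation parameters $\alpha_{in}\ge0$ with $\sum_n\alpha_{in}=1$; no-purchase weights $v_{0n}\ge0$; dissimilarity parameters $\sigma_n\in[0,1]$. $X\subseteq\{0,1\}^{m\times L}$ is the set of binary vectors satisfying given linear constraints; $x_{il}=1$ iff product $i$ is offered at price $p_{il}$. (A&P): maximize over $x\in X$ with $\sum_{l\in[L]}x_{il}\le1$ for all $i\in[m]$ (assumed feasible) $$F(x)=\frac{\sum_{i\in[m]}\sum_{l\in[L]}\sum_{n\in[N]}W_n^{\sigma_n-1}\alpha_{in}x_{il}v_{il}p_{il}}{\sum_{n\in[N]}W_n^{\sigma_n}},\qquad W_n=v_{0n}+\sum_{i\in[m]}\sum_{l\in[L]}\alpha_{in}x_{il}v_{il}.$$ Interpolants: let $L_n,U_n$ be the minimum and maximum of $W_n$ over feasible $x$, with $0<L_n<U_n$; $f^n(t)=t^{\sigma_n-1}$, $g^n(t)=t^{\sigma_n}$. Partition $[L_n,U_n]$ by $L_n=c^n_1<\dots<c^n_{K_n+1}=U_n$,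 and let $\widehat{f^n},\widehat{g^n}$ be the continuous piecewise affine interpolants of $f^n,g^n$ at the points $c^n_k$. "Maximum relative errors at most $\epsilon$" means $\max_{t\in[L_n,U_n]}(\widehat{f^n}(t)-f^n(t))/f^n(t)\le\epsilon$ and $\max_{t\in[L_n,U_n]}(g^n(t)-\widehat{g^n}(t))/g^n(t)\le\epsilon$ for all $n$. Let $\Delta_{nk}=c^n_{k+1}-c^n_k$, $\gamma^{fn}_k=(f^n(c^n_{k+1})-f^n(c^n_k))/\Delta_{nk}$, $\gamma^{gn}_k=(g^n(c^n_{k+1})-g^n(c^n_k))/\Delta_{nk}$. (A&P-LFP): with $a_{iln}=\alpha_{in}v_{il}p_{il}f^n(L_n)$, $b_{ilnk}=\alpha_{in}v_{il}p_{il}\gamma^{fn}_k\Delta_{nk}$, $c=\sum_ng^n(L_n)$, $d_{nk}=\Delta_{nk}\gamma^{gn}_k$, maximize over $x\in X$, $y_{nk}\in\{0,1\}$, $z_{nk}\in[0,1]$, $s_{ilnk}\in[0,1]$ $$\widehat F(x)=\frac{\sum_{i,l,n}a_{iln}x_{il}+\sum_{i,l,n,k}b_{ilnk}s_{ilnk}}{c+\sum_{n,k}d_{nk}z_{nk}}$$ subject to: $\sum_{l}x_{il}\le1$ for all $i$; $v_{0n}+\sum_{i,l}\alpha_{in}x_{il}v_{il}=L_n+\sum_{k\in[K_n]}\Delta_{nk}z_{nk}$ for all $n$; $y_{n,k+1}\le y_{nk}\le z_{nk}$ and $z_{n,k+1}\le y_{nk}$ for all $n$, $k\in[K_n-1]$;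 $s_{ilnk}\le x_{il}$, $s_{ilnk}\le z_{nk}$, $s_{ilnk}\ge x_{il}+z_{nk}-1$ for all $i,l,n$ and $k\in[K_n]$. *)

theory Defs
  imports "HOL-Analysis.Analysis"
begin

text \<open>
  Products are indexed by \<open>{1..num_products P}\<close>, price levels by \<open>{1..num_levels P}\<close> and nests
  by \<open>{1..num_nests P}\<close>.  The linear constraints defining the set $X$ are the inequalities
  $\sum_{i,l}$ \<open>con_coeff P r i l\<close> $x_{il} \le$ \<open>con_rhs P r\<close> for \<open>r \<in> {1..num_constraints P}\<close>;
  an equation is a pair of opposite inequalities.
\<close>

record ap_problem =
  num_products :: nat
  num_levels :: nat
  num_nests :: nat
  price :: "nat \<Rightarrow> nat \<Rightarrow> real"
  weight :: "nat \<Rightarrow> nat \<Rightarrow> real"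
  alloc :: "nat \<Rightarrow> nat \<Rightarrow> real"
  no_purchase :: "nat \<Rightarrow> real"
  dissim :: "nat \<Rightarrow> real"
  num_constraints :: nat
  con_coeff :: "nat \<Rightarrow> nat \<Rightarrow> nat \<Rightarrow> real"
  con_rhs :: "nat \<Rightarrow> real"

abbreviation Prods :: "ap_problem \<Rightarrow> nat set" where
  "Prods P \<equiv> {1..num_products P}"

abbreviation Levels :: "ap_problem \<Rightarrow> nat set" where
  "Levels P \<equiv> {1..num_levels P}"

abbreviation Nests :: "ap_problem \<Rightarrow> nat set" where
  "Nests P \<equiv> {1..num_nests P}"

definition ap_valid :: "ap_problem \<Rightarrow> bool" where
  "ap_valid P \<longleftrightarrow>
     (\<forall>i\<in>Prods P. \<forall>l\<in>Levels P. 0 \<le> price P i l \<and> 0 \<le> weight P i l) \<and>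
     (\<forall>i\<in>Prods P. \<forall>n\<in>Nests P. 0 \<le> alloc P i n) \<and>
     (\<forall>i\<in>Prods P. (\<Sum>n\<in>Nests P. alloc P i n) = 1) \<and>
     (\<forall>n\<in>Nests P. 0 \<le> no_purchase P n \<and> 0 \<le> dissim P n \<and> dissim P n \<le> 1)"

text \<open>
  Binary vectors are extensional functions, so that the set $X$ is finite.
\<close>

definition X_set :: "ap_problem \<Rightarrow> (nat \<Rightarrow> nat \<Rightarrow> real) set" where
  "X_set P = {x \<in> Prods P \<rightarrow>\<^sub>E (Levels P \<rightarrow>\<^sub>E {0, 1}).
     \<forall>r\<in>{1..num_constraints P}.
       (\<Sum>i\<in>Prods P. \<Sum>l\<in>Levels P. con_coeff P r i l * x i l) \<le> con_rhs P r}"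

definition ap_feasible :: "ap_problem \<Rightarrow> (nat \<Rightarrow> nat \<Rightarrow> real) set" where
  "ap_feasible P = {x \<in> X_set P. \<forall>i\<in>Prods P. (\<Sum>l\<in>Levels P. x i l) \<le> 1}"

definition nest_weight :: "ap_problem \<Rightarrow> (nat \<Rightarrow> nat \<Rightarrow> real) \<Rightarrow> nat \<Rightarrow> real" where
  "nest_weight P x n =
     no_purchase P n + (\<Sum>i\<in>Prods P. \<Sum>l\<in>Levels P. alloc P i n * x i l * weight P i l)"

definition f_fun :: "ap_problem \<Rightarrow> nat \<Rightarrow> real \<Rightarrow> real" where
  "f_fun P n t = t powr (dissim P n - 1)"

definition g_fun :: "ap_problem \<Rightarrow> nat \<Rightarrow> real \<Rightarrow> real" where
  "g_fun P n t = t powr dissim P n"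

definition revenue :: "ap_problem \<Rightarrow> (nat \<Rightarrow> nat \<Rightarrow> real) \<Rightarrow> real" where
  "revenue P x =
     (\<Sum>i\<in>Prods P. \<Sum>l\<in>Levels P. \<Sum>n\<in>Nests P.
        nest_weight P x n powr (dissim P n - 1) * alloc P i n * x i l * weight P i l * price P i l)
     / (\<Sum>n\<in>Nests P. nest_weight P x n powr dissim P n)"

definition W_min :: "ap_problem \<Rightarrow> nat \<Rightarrow> real" where
  "W_min P n = Min ((\<lambda>x. nest_weight P x n) ` ap_feasible P)"

definition W_max :: "ap_problem \<Rightarrow> nat \<Rightarrow> real" where
  "W_max P n = Max ((\<lambda>x. nest_weight P x n) ` ap_feasible P)"

definition breakpoints :: "real \<Rightarrow> real \<Rightarrow> nat \<Rightarrow> (nat \<Rightarrow> real) \<Rightarrow> bool" where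
  "breakpoints a b K c \<longleftrightarrow> c 1 = a \<and> c (K + 1) = b \<and> (\<forall>k\<in>{1..K}. c k < c (k + 1))"

definition pw_affine_interpolant ::
    "nat \<Rightarrow> (nat \<Rightarrow> real) \<Rightarrow> (real \<Rightarrow> real) \<Rightarrow> (real \<Rightarrow> real) \<Rightarrow> bool" where
  "pw_affine_interpolant K c h hh \<longleftrightarrow>
     continuous_on {c 1..c (K + 1)} hh \<and>
     (\<forall>k\<in>{1..K}. \<exists>a b. \<forall>t\<in>{c k..c (k + 1)}. hh t = a * t + b) \<and>
     (\<forall>k\<in>{1..K + 1}. hh (c k) = h (c k))"

definition width :: "(nat \<Rightarrow> nat \<Rightarrow> real) \<Rightarrow> nat \<Rightarrow> nat \<Rightarrow> real" where
  "width c n k = c n (k + 1) - c n k"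

definition slope_f :: "ap_problem \<Rightarrow> (nat \<Rightarrow> nat \<Rightarrow> real) \<Rightarrow> nat \<Rightarrow> nat \<Rightarrow> real" where
  "slope_f P c n k = (f_fun P n (c n (k + 1)) - f_fun P n (c n k)) / width c n k"

definition slope_g :: "ap_problem \<Rightarrow> (nat \<Rightarrow> nat \<Rightarrow> real) \<Rightarrow> nat \<Rightarrow> nat \<Rightarrow> real" where
  "slope_g P c n k = (g_fun P n (c n (k + 1)) - g_fun P n (c n k)) / width c n k"

definition lfp_a :: "ap_problem \<Rightarrow> nat \<Rightarrow> nat \<Rightarrow> nat \<Rightarrow> real" where
  "lfp_a P i l n = alloc P i n * weight P i l * price P i l * f_fun P n (W_min P n)"

definition lfp_b ::
    "ap_problem \<Rightarrow> (nat \<Rightarrow> nat \<Rightarrow> real) \<Rightarrow> nat \<Rightarrow> nat \<Rightarrow> nat \<Rightarrow> nat \<Rightarrow> real" where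
  "lfp_b P c i l n k = alloc P i n * weight P i l * price P i l * slope_f P c n k * width c n k"

definition lfp_c :: "ap_problem \<Rightarrow> real" where
  "lfp_c P = (\<Sum>n\<in>Nests P. g_fun P n (W_min P n))"

definition lfp_d :: "ap_problem \<Rightarrow> (nat \<Rightarrow> nat \<Rightarrow> real) \<Rightarrow> nat \<Rightarrow> nat \<Rightarrow> real" where
  "lfp_d P c n k = width c n k * slope_g P c n k"

definition lfp_objective ::
    "ap_problem \<Rightarrow> (nat \<Rightarrow> nat) \<Rightarrow> (nat \<Rightarrow> nat \<Rightarrow> real) \<Rightarrow>
     (nat \<Rightarrow> nat \<Rightarrow> real) \<Rightarrow> (nat \<Rightarrow> nat \<Rightarrow> real) \<Rightarrow> (nat \<Rightarrow> nat \<Rightarrow> nat \<Rightarrow> nat \<Rightarrow> real) \<Rightarrow> real" where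
  "lfp_objective P K c x z s =
     ((\<Sum>i\<in>Prods P. \<Sum>l\<in>Levels P. \<Sum>n\<in>Nests P. lfp_a P i l n * x i l) +
      (\<Sum>i\<in>Prods P. \<Sum>l\<in>Levels P. \<Sum>n\<in>Nests P. \<Sum>k\<in>{1..K n}. lfp_b P c i l n k * s i l n k))
     / (lfp_c P + (\<Sum>n\<in>Nests P. \<Sum>k\<in>{1..K n}. lfp_d P c n k * z n k))"

definition lfp_feasible ::
    "ap_problem \<Rightarrow> (nat \<Rightarrow> nat) \<Rightarrow> (nat \<Rightarrow> nat \<Rightarrow> real) \<Rightarrow>
     (nat \<Rightarrow> nat \<Rightarrow> real) \<Rightarrow> (nat \<Rightarrow> nat \<Rightarrow> real) \<Rightarrow> (nat \<Rightarrow> nat \<Rightarrow> real) \<Rightarrow>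
     (nat \<Rightarrow> nat \<Rightarrow> nat \<Rightarrow> nat \<Rightarrow> real) \<Rightarrow> bool" where
  "lfp_feasible P K c x y z s \<longleftrightarrow>
     x \<in> X_set P \<and>
     (\<forall>n\<in>Nests P. \<forall>k\<in>{1..K n}. y n k \<in> {0, 1} \<and> z n k \<in> {0..1}) \<and>
     (\<forall>i\<in>Prods P. \<forall>l\<in>Levels P. \<forall>n\<in>Nests P. \<forall>k\<in>{1..K n}. s i l n k \<in> {0..1}) \<and>
     (\<forall>i\<in>Prods P. (\<Sum>l\<in>Levels P. x i l) \<le> 1) \<and>
     (\<forall>n\<in>Nests P.
        no_purchase P n + (\<Sum>i\<in>Prods P. \<Sum>l\<in>Levels P. alloc P i n * x i l * weight P i l)
        = W_min P n + (\<Sum>k\<in>{1..K n}. width c n k * z n k)) \<and>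
     (\<forall>n\<in>Nests P. \<forall>k\<in>{1..<K n}.
        y n (k + 1) \<le> y n k \<and> y n k \<le> z n k \<and> z n (k + 1) \<le> y n k) \<and>
     (\<forall>i\<in>Prods P. \<forall>l\<in>Levels P. \<forall>n\<in>Nests P. \<forall>k\<in>{1..K n}.
        s i l n k \<le> x i l \<and> s i l n k \<le> z n k \<and> x i l + z n k - 1 \<le> s i l n k)"

end

theory Submission
  imports Defs
begin

text \<open>
  The constraints of (A&P-LFP) force \<open>z n\<close> to fill the cells of the partition from left to right
  and \<open>s i l n k = x i l * z n k\<close>, so its objective is the revenue with \<open>f\<close> and \<open>g\<close> replaced by
  their interpolants.  As \<open>f\<close> is convex and \<open>g\<close> is concave, the interpolants satisfy
  $f \le \hat f \le (1+\epsilon) f$ and $(1-\epsilon) g \le \hat g \le g$, whence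
  $F \le \hat F \le \frac{1+\epsilon}{1-\epsilon} F$ on the feasible set; comparing both optimal
  solutions under $\hat F$ gives the claim.
\<close>

section \<open>Vectors that fill the cells of a partition from left to right\<close>

text \<open>Normal form of a feasible \<open>z n\<close>: a point of the partitioned interval is
  encoded by the index \<open>k\<close> of a cell containing it and its relative position
  \<open>\<theta>\<close> in that cell.\<close>

definition filling :: "nat \<Rightarrow> real \<Rightarrow> nat \<Rightarrow> real" where
  "filling k \<theta> j = (if j < k then 1 else if j = k then \<theta> else 0)"

text \<open>The increments over the full cells telescope and cell \<open>k\<close> contributes the
  fraction \<open>\<theta>\<close>. With \<open>u\<close> the breakpoints this decodes the encoded
  point; with \<open>u\<close> the values at the breakpoints it gives the interpolant there.\<close>

lemma sum_diff_mult_filling: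
  fixes u :: "nat \<Rightarrow> real"
  assumes "k \<in> {1..K}"
  shows "(\<Sum>j\<in>{1..K}. (u (j + 1) - u j) * filling k \<theta> j)
    = u k - u 1 + \<theta> * (u (k + 1) - u k)"
proof -
  have split: "{1..K} = {1..<k} \<union> {k} \<union> {k<..K}"
    using assms by auto
  have "(\<Sum>j\<in>{1..<k}. (u (j + 1) - u j) * filling k \<theta> j) = (\<Sum>j\<in>{1..<k}. u (Suc j) - u j)"
    by (rule sum.cong) (auto simp: filling_def)
  also have "\<dots> = u k - u 1"
    using assms by (intro sum_Suc_diff') auto
  finally have 1: "(\<Sum>j\<in>{1..<k}. (u (j + 1) - u j) * filling k \<theta> j) = u k - u 1" .
  have 2: "(\<Sum>j\<in>{k<..K}. (u (j + 1) - u j) * filling k \<theta> j) = 0"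
    by (rule sum.neutral) (auto simp: filling_def)
  show ?thesis
    unfolding split
    by (subst sum.union_disjoint, simp, simp, fastforce)+
       (use 1 2 in \<open>simp add: filling_def\<close>)
qed

text \<open>The binary \<open>y\<close> between consecutive entries of \<open>z\<close> lets a cell
  be entered only once its predecessor is full, so only the last positive entry can be
  fractional.\<close>

lemma ordered_imp_filling:
  fixes y z :: "nat \<Rightarrow> real"
  assumes K: "K \<ge> 1"
    and yz: "\<And>k. k \<in> {1..K} \<Longrightarrow> y k \<in> {0, 1} \<and> z k \<in> {0..1}"
    and chain: "\<And>k. k \<in> {1..<K} \<Longrightarrow> y k \<le> z k \<and> z (k + 1) \<le> y k"
  obtains k \<theta> where "k \<in> {1..K}" "\<theta> \<in> {0..1}" "\<And>j. j \<in> {1..K} \<Longrightarrow> z j = filling k \<theta> j"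
proof -
  \<comment> \<open>Being binary and at least \<open>z (j + 1) > 0\<close>, \<open>y j\<close>
    equals 1, and \<open>y j \<le> z j\<close> passes this on to \<open>z j\<close>.\<close>
  have prev: "z j = 1" if "j \<in> {1..<K}" "z (j + 1) > 0" for j
    using yz[of j] chain[of j] that by auto
  \<comment> \<open>The inserted 1 covers \<open>z = 0\<close>, which is the filling with
    \<open>k = 1\<close> and \<open>\<theta> = 0\<close>.\<close>
  define k where "k = Max (insert 1 {j \<in> {1..K}. z j > 0})"
  have fin: "finite (insert 1 {j \<in> {1..K}. z j > 0})"
    by simp
  have kin: "k \<in> insert 1 {j \<in> {1..K}. z j > 0}"
    unfolding k_def using fin by (rule Max_in) simp
  hence k: "k \<in> {1..K}"
    using K by auto
  have above: "z j = 0" if "j \<in> {1..K}" "j > k" for j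
  proof (rule ccontr)
    assume "z j \<noteq> 0"
    hence "j \<in> insert 1 {j \<in> {1..K}. z j > 0}"
      using that yz[of j] by auto
    from Max_ge[OF fin this] show False
      using that unfolding k_def by linarith
  qed
  \<comment> \<open>Induction downwards from \<open>k\<close>. If \<open>Suc j = k\<close>, then
    \<open>j \<ge> 1\<close> excludes \<open>k = 1\<close>, so \<open>k\<close> is an index with
    \<open>z k > 0\<close>.\<close>
  have below: "z j = 1" if "1 \<le> j" "j < k" for j
    using \<open>j < k\<close>[THEN less_imp_le_nat] that
  proof (induction j rule: inc_induct)
    case base
    then show ?case by simp
  next
    case (step j)
    have "z (Suc j) > 0"
      using step kin by (cases "Suc j = k") auto
    then show ?case
      using step k prev[of j] by simp
  qed
  show thesis
  proof (rule that[OF k])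
    show "z k \<in> {0..1}"
      using yz k by blast
    show "z j = filling k (z k) j" if "j \<in> {1..K}" for j
      using that above[of j] below[of j] by (auto simp: filling_def)
  qed
qed

section \<open>Piecewise affine interpolants on a partition\<close>

lemma breakpoints_ex_cell:
  assumes "breakpoints a b K c" "a < b" "t \<in> {a..b}"
  obtains k where "k \<in> {1..K}" "t \<in> {c k..c (k + 1)}"
proof -
  have c: "c 1 = a" "c (K + 1) = b"
    using assms(1) by (auto simp: breakpoints_def)
  have "K \<noteq> 0"
    using c assms(2) by (cases K) auto
  \<comment> \<open>The last breakpoint not exceeding \<open>t\<close>, with \<open>K + 1\<close>
    left out so that \<open>t = b\<close> falls into the last cell.\<close>
  define k where "k = Max {j \<in> {1..K}. c j \<le> t}"
  have "k \<in> {j \<in> {1..K}. c j \<le> t}"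
    unfolding k_def using \<open>K \<noteq> 0\<close> c assms(3) by (intro Max_in) (auto intro: exI[of _ 1])
  moreover have "t \<le> c (k + 1)"
  proof (cases "k = K")
    case True
    then show ?thesis using c assms(3) by simp
  next
    case False
    with \<open>k \<in> {j \<in> {1..K}. c j \<le> t}\<close> have "k + 1 \<in> {1..K}"
      by auto
    moreover have "k + 1 \<notin> {j \<in> {1..K}. c j \<le> t}"
      using Max_ge[of "{j \<in> {1..K}. c j \<le> t}" "k + 1"] unfolding k_def by fastforce
    ultimately show ?thesis by auto
  qed
  ultimately show thesis
    by (intro that[of k]) auto
qed

text \<open>An affine function on a cell is determined by its two endpoint values; the coordinate
  \<open>\<theta>\<close> is the one used by \<open>filling\<close>.\<close>

lemma pw_affine_interpolant_cell:
  assumes "pw_affine_interpolant K c h hh" "k \<in> {1..K}" "c k \<le> c (k + 1)" "\<theta> \<in> {0..1}"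
  shows "hh (c k + \<theta> * (c (k + 1) - c k)) = h (c k) + \<theta> * (h (c (k + 1)) - h (c k))"
proof -
  obtain a b where ab: "\<forall>t\<in>{c k..c (k + 1)}. hh t = a * t + b"
    using assms(1,2) unfolding pw_affine_interpolant_def by blast
  have h: "h (c k) = a * c k + b" "h (c (k + 1)) = a * c (k + 1) + b"
    using assms ab by (auto simp: pw_affine_interpolant_def Ball_def)
  have "\<theta> * (c (k + 1) - c k) \<le> 1 * (c (k + 1) - c k)"
    using assms by (intro mult_right_mono) auto
  hence "c k + \<theta> * (c (k + 1) - c k) \<in> {c k..c (k + 1)}"
    using assms by auto
  thus ?thesis
    using ab h by (simp add: algebra_simps)
qed

text \<open>The same weights \<open>z\<close> decode both the point and the interpolant's value
  there, which is why (A&P-LFP) can express the interpolants linearly in \<open>z\<close>.\<close>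

lemma pw_affine_interpolant_filling:
  fixes z :: "nat \<Rightarrow> real"
  assumes bp: "breakpoints a b K c" and int: "pw_affine_interpolant K c h hh"
    and k: "k \<in> {1..K}" and \<theta>: "\<theta> \<in> {0..1}"
    and z: "\<And>j. j \<in> {1..K} \<Longrightarrow> z j = filling k \<theta> j"
  shows "hh (a + (\<Sum>j\<in>{1..K}. (c (j + 1) - c j) * z j))
    = h a + (\<Sum>j\<in>{1..K}. (h (c (j + 1)) - h (c j)) * z j)"
proof -
  have *: "(\<Sum>j\<in>{1..K}. (u (j + 1) - u j) * z j) = u k - u 1 + \<theta> * (u (k + 1) - u k)"
    for u :: "nat \<Rightarrow> real"
    using sum_diff_mult_filling[OF k, of u \<theta>] z by simp
  have "c 1 = a" "c k < c (k + 1)"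
    using bp k by (auto simp: breakpoints_def)
  thus ?thesis
    using *[of c] *[of "\<lambda>j. h (c j)"] pw_affine_interpolant_cell[OF int k _ \<theta>]
    by simp
qed

lemma breakpoints_ge:
  assumes "breakpoints a b K c" "k \<in> {1..K + 1}"
  shows "a \<le> c k"
proof -
  have "1 \<le> k" "k \<le> K + 1"
    using assms by auto
  thus ?thesis
  proof (induction k rule: dec_induct)
    case base
    then show ?case using assms by (simp add: breakpoints_def)
  next
    case (step k)
    then show ?case using assms(1) by (force simp: breakpoints_def)
  qed
qed

text \<open>On each cell \<open>hh\<close> is the chord of \<open>h\<close>, and a convex function
  lies below its chords.\<close>

lemma pw_affine_interpolant_ge_convex:
  assumes bp: "breakpoints a b K c" "a < b" and int: "pw_affine_interpolant K c h hh"
    and cvx: "convex_on {a..} h" and t: "t \<in> {a..b}"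
  shows "h t \<le> hh t"
proof -
  obtain k where k: "k \<in> {1..K}" "t \<in> {c k..c (k + 1)}"
    using breakpoints_ex_cell[OF bp t] .
  have less: "c k < c (k + 1)" and ge: "a \<le> c k"
    using bp k breakpoints_ge[OF bp(1), of k] by (auto simp: breakpoints_def)
  define \<theta> where "\<theta> = (t - c k) / (c (k + 1) - c k)"
  have \<theta>: "\<theta> \<in> {0..1}" and t_eq: "t = c k + \<theta> * (c (k + 1) - c k)"
    using k less by (auto simp: \<theta>_def field_simps)
  have "t = (1 - \<theta>) *\<^sub>R c k + \<theta> *\<^sub>R c (k + 1)"
    using t_eq by (simp add: algebra_simps)
  hence "h t \<le> (1 - \<theta>) * h (c k) + \<theta> * h (c (k + 1))"
    using convex_onD[OF cvx, of \<theta> "c k" "c (k + 1)"] \<theta> ge less by simp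
  also have "\<dots> = hh t"
    unfolding t_eq using pw_affine_interpolant_cell[OF int k(1) _ \<theta>] less
    by (simp add: algebra_simps)
  finally show ?thesis .
qed

lemma pw_affine_interpolant_uminus:
  assumes "pw_affine_interpolant K c h hh"
  shows "pw_affine_interpolant K c (\<lambda>t. - h t) (\<lambda>t. - hh t)"
  unfolding pw_affine_interpolant_def
proof (intro conjI ballI)
  fix k assume "k \<in> {1..K}"
  then obtain a b where "\<forall>t\<in>{c k..c (k + 1)}. hh t = a * t + b"
    using assms unfolding pw_affine_interpolant_def by blast
  hence "\<forall>t\<in>{c k..c (k + 1)}. - hh t = (- a) * t + (- b)"
    by simp
  thus "\<exists>a b. \<forall>t\<in>{c k..c (k + 1)}. - hh t = a * t + b"
    by blast
qed (use assms in \<open>auto simp: pw_affine_interpolant_def intro!: continuous_intros\<close>)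

lemma pw_affine_interpolant_le_concave:
  assumes "breakpoints a b K c" "a < b" "pw_affine_interpolant K c h hh"
    and "concave_on {a..} h" "t \<in> {a..b}"
  shows "hh t \<le> h t"
  using pw_affine_interpolant_ge_convex[OF assms(1,2) pw_affine_interpolant_uminus[OF assms(3)]]
    assms(4,5) by (simp add: concave_on_def)

section \<open>Convexity of \<open>f\<close> and concavity of \<open>g\<close>\<close>

lemma convex_on_f_fun:
  assumes "0 < a" "dissim P n \<in> {0..1}"
  shows "convex_on {a..} (f_fun P n)"
proof (rule f''_ge0_imp_convex)
  fix t :: real assume t: "t \<in> {a..}"
  let ?p = "dissim P n - 1"
  show "(f_fun P n has_real_derivative ?p * t powr (?p - 1)) (at t)"
    unfolding f_fun_def[abs_def] using t assms by (auto intro!: derivative_eq_intros)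
  show "((\<lambda>t. ?p * t powr (?p - 1)) has_real_derivative ?p * (?p - 1) * t powr (?p - 2)) (at t)"
    using t assms by (auto intro!: derivative_eq_intros)
  \<comment> \<open>Both \<open>?p = \<sigma> - 1\<close> and \<open>?p - 1\<close> are nonpositive,
    where \<open>\<sigma>\<close> is \<open>dissim P n\<close>.\<close>
  show "0 \<le> ?p * (?p - 1) * t powr (?p - 2)"
    using assms by (intro mult_nonneg_nonneg mult_nonpos_nonpos) auto
qed simp

lemma concave_on_g_fun:
  assumes "0 < a" "dissim P n \<in> {0..1}"
  shows "concave_on {a..} (g_fun P n)"
proof (rule f''_le0_imp_concave)
  fix t :: real assume t: "t \<in> {a..}"
  let ?p = "dissim P n"
  show "(g_fun P n has_real_derivative ?p * t powr (?p - 1)) (at t)"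
    unfolding g_fun_def[abs_def] using t assms by (auto intro!: derivative_eq_intros)
  show "((\<lambda>t. ?p * t powr (?p - 1)) has_real_derivative ?p * (?p - 1) * t powr (?p - 2)) (at t)"
    using t assms by (auto intro!: derivative_eq_intros)
  \<comment> \<open>Here \<open>?p\<close> is the dissimilarity parameter itself, so
    \<open>?p \<ge> 0\<close> while \<open>?p - 1 \<le> 0\<close>.\<close>
  show "?p * (?p - 1) * t powr (?p - 2) \<le> 0"
    using assms by (intro mult_nonpos_nonneg mult_nonneg_nonpos) auto
qed simp

section \<open>Comparison of the exact and the interpolated objective\<close>

definition nest_ratio ::
    "ap_problem \<Rightarrow> (nat \<Rightarrow> real \<Rightarrow> real) \<Rightarrow> (nat \<Rightarrow> real \<Rightarrow> real) \<Rightarrow> (nat \<Rightarrow> nat \<Rightarrow> real) \<Rightarrow> real" where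
  "nest_ratio P \<phi> \<psi> x =
     (\<Sum>i\<in>Prods P. \<Sum>l\<in>Levels P. \<Sum>n\<in>Nests P.
        \<phi> n (nest_weight P x n) * (alloc P i n * x i l * weight P i l * price P i l))
     / (\<Sum>n\<in>Nests P. \<psi> n (nest_weight P x n))"

lemma revenue_eq_nest_ratio: "revenue P = nest_ratio P (f_fun P) (g_fun P)"
  by (rule ext) (simp add: revenue_def nest_ratio_def f_fun_def g_fun_def mult.assoc)

lemma X_set_binary: "x \<in> X_set P \<Longrightarrow> i \<in> Prods P \<Longrightarrow> l \<in> Levels P \<Longrightarrow> x i l = 0 \<or> x i l = 1"
  by (fastforce simp: X_set_def dest: PiE_mem)

lemma finite_ap_feasible: "finite (ap_feasible P)"
proof (rule finite_subset)
  show "ap_feasible P \<subseteq> Prods P \<rightarrow>\<^sub>E (Levels P \<rightarrow>\<^sub>E {0, 1})"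
    by (auto simp: ap_feasible_def X_set_def)
  show "finite (Prods P \<rightarrow>\<^sub>E (Levels P \<rightarrow>\<^sub>E {0, 1 :: real}))"
    by (intro finite_PiE) auto
qed

lemma nest_weight_bounds:
  assumes "x \<in> ap_feasible P"
  shows "nest_weight P x n \<in> {W_min P n..W_max P n}"
  using assms finite_ap_feasible[of P] by (auto simp: W_min_def W_max_def intro!: Min_le Max_ge)

lemma nest_ratio_le:
  assumes valid: "ap_valid P" and x: "x \<in> X_set P" and "0 < b"
    and \<phi>: "\<And>n. n \<in> Nests P \<Longrightarrow> 0 \<le> \<phi> n (nest_weight P x n) \<and>
          \<phi> n (nest_weight P x n) \<le> a * \<phi>' n (nest_weight P x n)"
    and \<psi>: "\<And>n. n \<in> Nests P \<Longrightarrow> 0 < \<psi>' n (nest_weight P x n) \<and>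
          b * \<psi>' n (nest_weight P x n) \<le> \<psi> n (nest_weight P x n)"
  shows "nest_ratio P \<phi> \<psi> x \<le> a / b * nest_ratio P \<phi>' \<psi>' x"
proof (cases "Nests P = {}")
  \<comment> \<open>Without nests the denominators vanish, but the numerators are sums of empty sums
    and both sides are 0.\<close>
  case True
  then show ?thesis by (simp add: nest_ratio_def)
next
  case False
  define w where "w i l n = alloc P i n * x i l * weight P i l * price P i l" for i l n
  define A where "A \<phi> = (\<Sum>i\<in>Prods P. \<Sum>l\<in>Levels P. \<Sum>n\<in>Nests P.
        \<phi> n (nest_weight P x n) * w i l n)"
    for \<phi> :: "nat \<Rightarrow> real \<Rightarrow> real"
  define B where "B \<psi> = (\<Sum>n\<in>Nests P. \<psi> n (nest_weight P x n))" for \<psi> :: "nat \<Rightarrow> real \<Rightarrow> real"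
  have w: "0 \<le> w i l n"
    if "i \<in> Prods P" "l \<in> Levels P" "n \<in> Nests P" for i l n
  proof -
    have "0 \<le> x i l"
      using X_set_binary[OF x that(1,2)] by auto
    thus ?thesis
      using valid that by (auto simp: w_def ap_valid_def)
  qed
  have "0 \<le> A \<phi>"
    unfolding A_def using \<phi> w by (intro sum_nonneg mult_nonneg_nonneg) blast+
  moreover have "A \<phi> \<le> a * A \<phi>'"
  proof -
    have "A \<phi> \<le> A (\<lambda>n t. a * \<phi>' n t)"
      unfolding A_def using \<phi> w by (intro sum_mono mult_right_mono) blast+
    also have "\<dots> = a * A \<phi>'"
      by (simp add: A_def sum_distrib_left mult.assoc)
    finally show ?thesis .
  qed
  moreover have "0 < B \<psi>'"
    unfolding B_def using \<psi> False by (intro sum_pos) auto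
  moreover have "b * B \<psi>' \<le> B \<psi>"
    unfolding B_def sum_distrib_left using \<psi> by (intro sum_mono) auto
  ultimately have "A \<phi> / B \<psi> \<le> (a * A \<phi>') / (b * B \<psi>')"
    using \<open>0 < b\<close> by (intro frac_le) auto
  thus ?thesis
    by (simp add: nest_ratio_def A_def B_def w_def)
qed

section \<open>(A&P-LFP) for a fixed assortment\<close>

lemma lfp_feasible_ap_feasible: "lfp_feasible P K c x y z s \<Longrightarrow> x \<in> ap_feasible P"
  by (simp add: lfp_feasible_def ap_feasible_def)

locale nest_partition =
  fixes P :: ap_problem and K :: "nat \<Rightarrow> nat" and c :: "nat \<Rightarrow> nat \<Rightarrow> real"
  assumes W_min_less: "n \<in> Nests P \<Longrightarrow> W_min P n < W_max P n"
    and partition: "n \<in> Nests P \<Longrightarrow> breakpoints (W_min P n) (W_max P n) (K n) (c n)"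
begin

lemma K_pos: "n \<in> Nests P \<Longrightarrow> K n \<ge> 1"
  using W_min_less[of n] partition[of n] by (cases "K n") (auto simp: breakpoints_def)

lemma width_pos: "n \<in> Nests P \<Longrightarrow> k \<in> {1..K n} \<Longrightarrow> 0 < width c n k"
  using partition[of n] by (auto simp: breakpoints_def width_def)

text \<open>This holds for every feasible choice of \<open>y\<close>, \<open>z\<close>,
  \<open>s\<close>, so the objective depends on \<open>x\<close> alone.\<close>

lemma lfp_objective_eq_nest_ratio:
  assumes int_f: "\<And>n. n \<in> Nests P \<Longrightarrow> pw_affine_interpolant (K n) (c n) (f_fun P n) (fhat n)"
    and int_g: "\<And>n. n \<in> Nests P \<Longrightarrow> pw_affine_interpolant (K n) (c n) (g_fun P n) (ghat n)"
    and feas: "lfp_feasible P K c x y z s"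
  shows "lfp_objective P K c x z s = nest_ratio P fhat ghat x"
proof -
  have interpolant: "hh (nest_weight P x n) = h (W_min P n)
      + (\<Sum>k\<in>{1..K n}. (h (c n (k + 1)) - h (c n k)) * z n k)"
    if n: "n \<in> Nests P" and int: "pw_affine_interpolant (K n) (c n) h hh" for n h hh
  proof -
    have yz: "\<And>k. k \<in> {1..K n} \<Longrightarrow> y n k \<in> {0, 1} \<and> z n k \<in> {0..1}"
      and chain: "\<And>k. k \<in> {1..<K n} \<Longrightarrow> y n k \<le> z n k \<and> z n (k + 1) \<le> y n k"
      and W: "nest_weight P x n = W_min P n + (\<Sum>k\<in>{1..K n}. (c n (k + 1) - c n k) * z n k)"
      using feas n unfolding lfp_feasible_def nest_weight_def width_def by blast+
    obtain k \<theta> where "k \<in> {1..K n}" "\<theta> \<in> {0..1}"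
      "\<And>j. j \<in> {1..K n} \<Longrightarrow> z n j = filling k \<theta> j"
      using ordered_imp_filling[OF K_pos[OF n], of "y n" "z n"] yz chain by metis
    thus ?thesis
      unfolding W by (rule pw_affine_interpolant_filling[OF partition[OF n] int])
  qed
  \<comment> \<open>If \<open>x i l = 0\<close>, then \<open>s\<close> is squeezed between 0 and
    \<open>x i l\<close>; if \<open>x i l = 1\<close>, between \<open>z n k\<close> and
    \<open>z n k\<close>.\<close>
  have s: "s i l n k = x i l * z n k"
    if "i \<in> Prods P" "l \<in> Levels P" "n \<in> Nests P" "k \<in> {1..K n}" for i l n k
  proof -
    have "s i l n k \<in> {0..1}" "s i l n k \<le> x i l" "s i l n k \<le> z n k" "x i l + z n k - 1 \<le> s i l n k"
      "x i l = 0 \<or> x i l = 1"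
      using feas that X_set_binary[of x P i l] unfolding lfp_feasible_def by blast+
    thus ?thesis by auto
  qed
  have numer: "lfp_a P i l n * x i l + (\<Sum>k\<in>{1..K n}. lfp_b P c i l n k * s i l n k)
      = fhat n (nest_weight P x n) * (alloc P i n * x i l * weight P i l * price P i l)"
    if "i \<in> Prods P" "l \<in> Levels P" "n \<in> Nests P" for i l n
  proof -
    \<comment> \<open>Slope times width is the increment of \<open>f\<close> over the cell, as
      widths are nonzero.\<close>
    have "(\<Sum>k\<in>{1..K n}. lfp_b P c i l n k * s i l n k)
      = (\<Sum>k\<in>{1..K n}. (alloc P i n * x i l * weight P i l * price P i l) *
          ((f_fun P n (c n (k + 1)) - f_fun P n (c n k)) * z n k))"
      using s that width_pos[of n]
      by (intro sum.cong) (auto simp: lfp_b_def slope_f_def less_imp_neq[symmetric])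
    also have "\<dots> = (alloc P i n * x i l * weight P i l * price P i l) *
        (fhat n (nest_weight P x n) - f_fun P n (W_min P n))"
      using interpolant[OF that(3) int_f[OF that(3)]] by (simp add: sum_distrib_left)
    finally show ?thesis
      by (simp add: lfp_a_def algebra_simps)
  qed
  have denom: "g_fun P n (W_min P n) + (\<Sum>k\<in>{1..K n}. lfp_d P c n k * z n k)
      = ghat n (nest_weight P x n)" if "n \<in> Nests P" for n
  proof -
    have "(\<Sum>k\<in>{1..K n}. lfp_d P c n k * z n k)
      = (\<Sum>k\<in>{1..K n}. (g_fun P n (c n (k + 1)) - g_fun P n (c n k)) * z n k)"
      using that width_pos[of n]
      by (intro sum.cong) (auto simp: lfp_d_def slope_g_def less_imp_neq[symmetric])
    thus ?thesis
      using interpolant[OF that int_g] that by simp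
  qed
  show ?thesis
    unfolding lfp_objective_def nest_ratio_def lfp_c_def sum.distrib[symmetric]
    using numer denom by simp
qed

text \<open>Lets the optimum of (A&P) compete in (A&P-LFP): each nest weight lies in some cell, and
  its position there prescribes a filling.\<close>

lemma lfp_feasible_exists:
  assumes x: "x \<in> ap_feasible P"
  obtains y z s where "lfp_feasible P K c x y z s"
proof -
  have "\<exists>k \<theta>. k \<in> {1..K n} \<and> \<theta> \<in> {0..1} \<and>
      nest_weight P x n = W_min P n + (\<Sum>k'\<in>{1..K n}. width c n k' * filling k \<theta> k')"
    if n: "n \<in> Nests P" for n
  proof -
    obtain k where k: "k \<in> {1..K n}" "nest_weight P x n \<in> {c n k..c n (k + 1)}"
      using breakpoints_ex_cell[OF partition[OF n] W_min_less[OF n] nest_weight_bounds[OF x]] .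
    let ?\<theta> = "(nest_weight P x n - c n k) / (c n (k + 1) - c n k)"
    have pos: "0 < c n (k + 1) - c n k"
      using width_pos[OF n k(1)] by (simp add: width_def)
    have "?\<theta> \<in> {0..1}"
      using k pos by (auto simp: field_simps)
    moreover have "nest_weight P x n
        = W_min P n + (\<Sum>k'\<in>{1..K n}. width c n k' * filling k ?\<theta> k')"
      using sum_diff_mult_filling[OF k(1), of "c n" ?\<theta>] partition[OF n] pos
      by (simp add: width_def breakpoints_def)
    ultimately show ?thesis
      using k(1) by blast
  qed
  then obtain \<kappa> \<theta> where \<kappa>: "\<And>n. n \<in> Nests P \<Longrightarrow> \<theta> n \<in> {0..1} \<and>
      nest_weight P x n = W_min P n + (\<Sum>k\<in>{1..K n}. width c n k * filling (\<kappa> n) (\<theta> n) k)"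
    by metis
  define z where "z n = filling (\<kappa> n) (\<theta> n)" for n
  \<comment> \<open>\<open>y\<close> marks the cells strictly before \<open>\<kappa> n\<close>:
    these are full, and a cell after an unmarked one is empty, as the chain constraints
    demand.\<close>
  define y where "y n k = (if k < \<kappa> n then 1 else 0 :: real)" for n k
  have yz: "y n k \<in> {0, 1} \<and> z n k \<in> {0..1}" "y n (k + 1) \<le> y n k \<and> y n k \<le> z n k \<and> z n (k + 1) \<le> y n k"
    if "n \<in> Nests P" for n k
    using \<kappa>[OF that] by (auto simp: y_def z_def filling_def)
  \<comment> \<open>The product is the value of \<open>s\<close> that the linearization constraints
    describe.\<close>
  have "lfp_feasible P K c x y z (\<lambda>i l n k. x i l * z n k)"
    unfolding lfp_feasible_def
  proof (intro conjI ballI)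
    show "x \<in> X_set P" "\<And>i. i \<in> Prods P \<Longrightarrow> (\<Sum>l\<in>Levels P. x i l) \<le> 1"
      using x by (auto simp: ap_feasible_def)
  next
    fix i l n k assume *: "i \<in> Prods P" "l \<in> Levels P" "n \<in> Nests P" "k \<in> {1..K n}"
    have "x i l = 0 \<or> x i l = 1" "z n k \<in> {0..1}"
      using x * yz(1)[of n k] X_set_binary[of x P i l] by (auto simp: ap_feasible_def)
    thus "x i l * z n k \<in> {0..1}" "x i l * z n k \<le> x i l" "x i l * z n k \<le> z n k"
      "x i l + z n k - 1 \<le> x i l * z n k"
      by auto
  next
    fix n assume "n \<in> Nests P"
    thus "no_purchase P n + (\<Sum>i\<in>Prods P. \<Sum>l\<in>Levels P. alloc P i n * x i l * weight P i l)
        = W_min P n + (\<Sum>k\<in>{1..K n}. width c n k * z n k)"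
      using \<kappa> unfolding z_def nest_weight_def by blast
  qed (use yz in auto)
  thus thesis by (rule that)
qed

end

section \<open>The approximation guarantee\<close>

theorem corollary3:
  fixes P :: ap_problem
    and K :: "nat \<Rightarrow> nat" and c :: "nat \<Rightarrow> nat \<Rightarrow> real"
    and fhat ghat :: "nat \<Rightarrow> real \<Rightarrow> real"
    and \<epsilon> :: real
    and xstar xhat :: "nat \<Rightarrow> nat \<Rightarrow> real"
    and yhat zhat :: "nat \<Rightarrow> nat \<Rightarrow> real"
    and shat :: "nat \<Rightarrow> nat \<Rightarrow> nat \<Rightarrow> nat \<Rightarrow> real"
  assumes valid: "ap_valid P"
    and feasible: "ap_feasible P \<noteq> {}"
    and bounds: "\<And>n. n \<in> Nests P \<Longrightarrow> 0 < W_min P n \<and> W_min P n < W_max P n"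
    and partition: "\<And>n. n \<in> Nests P \<Longrightarrow> breakpoints (W_min P n) (W_max P n) (K n) (c n)"
    and interp_f: "\<And>n. n \<in> Nests P \<Longrightarrow> pw_affine_interpolant (K n) (c n) (f_fun P n) (fhat n)"
    and interp_g: "\<And>n. n \<in> Nests P \<Longrightarrow> pw_affine_interpolant (K n) (c n) (g_fun P n) (ghat n)"
    and eps: "0 < \<epsilon>" "\<epsilon> < 1"
    and err_f: "\<And>n t. n \<in> Nests P \<Longrightarrow> t \<in> {W_min P n..W_max P n} \<Longrightarrow>
                  (fhat n t - f_fun P n t) / f_fun P n t \<le> \<epsilon>"
    and err_g: "\<And>n t. n \<in> Nests P \<Longrightarrow> t \<in> {W_min P n..W_max P n} \<Longrightarrow>
                  (g_fun P n t - ghat n t) / g_fun P n t \<le> \<epsilon>"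
    and opt: "is_arg_max (revenue P) (\<lambda>x. x \<in> ap_feasible P) xstar"
    and opt_lfp: "is_arg_max (\<lambda>(x, y, z, s). lfp_objective P K c x z s)
                    (\<lambda>(x, y, z, s). lfp_feasible P K c x y z s) (xhat, yhat, zhat, shat)"
  shows "(1 - \<epsilon>) / (1 + \<epsilon>) * revenue P xstar \<le> revenue P xhat \<and>
         revenue P xhat \<le> revenue P xstar"
proof -
  interpret nest_partition P K c
    by unfold_locales (simp_all add: bounds partition)
  \<comment> \<open>Convexity and concavity give the one-sided bounds by \<open>f\<close> and
    \<open>g\<close>, the relative errors the opposite ones; \<open>\<epsilon> < 1\<close> keeps
    \<open>ghat\<close> positive.\<close>
  have estimates: "0 < f_fun P n t" "f_fun P n t \<le> fhat n t" "fhat n t \<le> (1 + \<epsilon>) * f_fun P n t"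
      "0 < g_fun P n t" "(1 - \<epsilon>) * g_fun P n t \<le> ghat n t" "ghat n t \<le> g_fun P n t"
      "0 \<le> fhat n t" "0 < ghat n t"
    if n: "n \<in> Nests P" and t: "t \<in> {W_min P n..W_max P n}" for n t
  proof -
    have W: "0 < W_min P n" and \<sigma>: "dissim P n \<in> {0..1}"
      using bounds[OF n] valid n by (auto simp: ap_valid_def)
    show f: "0 < f_fun P n t" and g: "0 < g_fun P n t"
      using W t by (auto simp: f_fun_def g_fun_def)
    show f': "f_fun P n t \<le> fhat n t"
      by (rule pw_affine_interpolant_ge_convex
            [OF partition[OF n] W_min_less[OF n] interp_f[OF n] convex_on_f_fun[OF W \<sigma>] t])
    show "ghat n t \<le> g_fun P n t"
      by (rule pw_affine_interpolant_le_concave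
            [OF partition[OF n] W_min_less[OF n] interp_g[OF n] concave_on_g_fun[OF W \<sigma>] t])
    show "fhat n t \<le> (1 + \<epsilon>) * f_fun P n t"
      using err_f[OF n t] f by (simp add: field_simps)
    show "0 \<le> fhat n t"
      using f f' by linarith
    show g': "(1 - \<epsilon>) * g_fun P n t \<le> ghat n t"
      using err_g[OF n t] g by (simp add: field_simps)
    have "0 < (1 - \<epsilon>) * g_fun P n t"
      using g eps by simp
    thus "0 < ghat n t"
      using g' by linarith
  qed
  have lower: "revenue P x \<le> nest_ratio P fhat ghat x"
    and upper: "nest_ratio P fhat ghat x \<le> (1 + \<epsilon>) / (1 - \<epsilon>) * revenue P x"
    if x: "x \<in> ap_feasible P" for x
  proof -
    have X: "x \<in> X_set P"
      using x by (simp add: ap_feasible_def)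
    note e = estimates[OF _ nest_weight_bounds[OF x]]
    have "nest_ratio P (f_fun P) (g_fun P) x \<le> 1 / 1 * nest_ratio P fhat ghat x"
      using e by (intro nest_ratio_le[OF valid X]) (auto intro: less_imp_le)
    thus "revenue P x \<le> nest_ratio P fhat ghat x"
      by (simp add: revenue_eq_nest_ratio)
    show "nest_ratio P fhat ghat x \<le> (1 + \<epsilon>) / (1 - \<epsilon>) * revenue P x"
      unfolding revenue_eq_nest_ratio
      using e eps by (intro nest_ratio_le[OF valid X]) (auto intro: less_imp_le order_trans)
  qed
  have objective: "lfp_objective P K c x z s = nest_ratio P fhat ghat x"
    if "lfp_feasible P K c x y z s" for x y z s
    by (rule lfp_objective_eq_nest_ratio[OF _ _ that]) (use interp_f interp_g in blast)+
  have xstar: "xstar \<in> ap_feasible P"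
    using opt by (simp add: is_arg_max_def)
  have feas_hat: "lfp_feasible P K c xhat yhat zhat shat"
    using opt_lfp by (simp add: is_arg_max_def)
  hence xhat: "xhat \<in> ap_feasible P"
    by (rule lfp_feasible_ap_feasible)
  obtain y z s where feas_star: "lfp_feasible P K c xstar y z s"
    using lfp_feasible_exists[OF xstar] .
  have "lfp_objective P K c xstar z s \<le> lfp_objective P K c xhat zhat shat"
    using opt_lfp feas_star by (force simp: is_arg_max_def not_less)
  hence "revenue P xstar \<le> (1 + \<epsilon>) / (1 - \<epsilon>) * revenue P xhat"
    using objective[OF feas_star] objective[OF feas_hat] lower[OF xstar] upper[OF xhat] by simp
  hence "(1 - \<epsilon>) / (1 + \<epsilon>) * revenue P xstar
      \<le> (1 - \<epsilon>) / (1 + \<epsilon>) * ((1 + \<epsilon>) / (1 - \<epsilon>) * revenue P xhat)"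
    using eps by (intro mult_left_mono) auto
  also have "\<dots> = revenue P xhat"
    using eps by simp
  \<comment> \<open>The upper bound is the optimality of \<open>xstar\<close>, since
    \<open>xhat\<close> is feasible for (A&P).\<close>
  finally show ?thesis
    using opt xhat by (auto simp: is_arg_max_def not_less)
qed

end
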